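(* Let $k\in\mathbb N$, and consider a hole over $[c,d]\subset(a,b)$ with lower and upper boundary functions $g,h$, which is the interior of a closed boundary curve $\Gamma\in C^{2k}$ such that every vertical line at $x\in(c,d)$ cuts $\Gamma$ at exactly two points, and such that $\Gamma$ has non-zero curvature at both points of change of topology $(c,h(c))$ and $(d,h(d))$. Let $(p_x,p_y)$ be the approximation of the left point of change of topology $(c,h(c))=(c,g(c))$ defined in the context from samples at $x_i=a+i\Delta$, $\Delta=(b-a)/N$. Then the Euclidean distance $E$ between $(c,h(c))$ and $(p_x,p_y)$ satisfies $$E=O(\Delta^{k-0.5})\quad\text{as }\Delta\to0 .$$ In particular, $|c-p_x|=O(\Delta^k)$ and $|h(c)-p_y|=O(\Delta^{k-1/2})$.
   Context: The hole is $\{(x,y): g(x)<y<h(x),\ x\in(c,d)\}$ with $a<c<d<b$, $g(c)=h(c)$, $g(d)=h(d)$; $\Gamma$ is the union of the graphs of $g$ and $h$ over $[c,d]$. Let $x_n,\dots,x_m$ be all the points $x_i=a+i\Delta$ ($0\le i\le N$) lying in $(c,d)$, with $m-n>2k$. Let $p_{2k-1}(y)$ be the polynomial of degree at most $2k-1$ interpolating the reflected data points $(g(x_i),x_i)$ and $(h(x_i),x_i)$, $i=n,\dots,n+k-1$, i.e. $p_{2k-1}(g(x_i))=x_i=p_{2k-1}(h(x_i))$. Let $\tilde y_p$ be a minimum point of $p_{2k-1}$ over the interval $[g(x_{n+k-1}),h(x_{n+k-1})]$. Then $(p_x,p_y):=(p_{2k-1}(\tilde y_p),\tilde y_p)$.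 *)

theory Defs
  imports
    "HOL-Analysis.Analysis"
    "HOL-Computational_Algebra.Polynomial"
    "HOL-Library.Landau_Symbols"
begin

definition vderiv :: "(real \<Rightarrow> 'a::real_normed_vector) \<Rightarrow> real \<Rightarrow> 'a" where
  "vderiv \<gamma> = (\<lambda>t. vector_derivative \<gamma> (at t))"

definition C_differentiable :: "nat \<Rightarrow> (real \<Rightarrow> 'a::real_normed_vector) \<Rightarrow> bool" where
  "C_differentiable r \<gamma> \<longleftrightarrow>
     (\<forall>i<r. \<forall>t. (vderiv ^^ i) \<gamma> differentiable (at t)) \<and> continuous_on UNIV ((vderiv ^^ r) \<gamma>)"

(* \<gamma> is a regular simple closed parametrization of class C^r of the set \<Gamma>.  It is taken as a
   1-periodic map on the whole line, so that it is also C^r across the point \<gamma> 0 = \<gamma> 1. *)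
definition closed_curve_param ::
    "nat \<Rightarrow> (real \<Rightarrow> real \<times> real) \<Rightarrow> (real \<times> real) set \<Rightarrow> bool" where
  "closed_curve_param r \<gamma> \<Gamma> \<longleftrightarrow>
     C_differentiable r \<gamma> \<and> (\<forall>t. vderiv \<gamma> t \<noteq> 0) \<and> (\<forall>t. \<gamma> (t + 1) = \<gamma> t) \<and>
     simple_path \<gamma> \<and> path_image \<gamma> = \<Gamma>"

definition curvature :: "(real \<Rightarrow> real \<times> real) \<Rightarrow> real \<Rightarrow> real" where
  "curvature \<gamma> t =
     (fst (vderiv \<gamma> t) * snd (vderiv (vderiv \<gamma>) t) - snd (vderiv \<gamma> t) * fst (vderiv (vderiv \<gamma>) t))
       / norm (vderiv \<gamma> t) ^ 3"

definition hole_region ::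
    "(real \<Rightarrow> real) \<Rightarrow> (real \<Rightarrow> real) \<Rightarrow> real \<Rightarrow> real \<Rightarrow> (real \<times> real) set" where
  "hole_region g h c d = {(x, y). c < x \<and> x < d \<and> g x < y \<and> y < h x}"

definition hole_boundary ::
    "(real \<Rightarrow> real) \<Rightarrow> (real \<Rightarrow> real) \<Rightarrow> real \<Rightarrow> real \<Rightarrow> (real \<times> real) set" where
  "hole_boundary g h c d = {(x, y). c \<le> x \<and> x \<le> d \<and> (y = g x \<or> y = h x)}"

definition mesh :: "real \<Rightarrow> real \<Rightarrow> nat \<Rightarrow> real" where
  "mesh a b N = (b - a) / real N"

definition sample_pt :: "real \<Rightarrow> real \<Rightarrow> nat \<Rightarrow> nat \<Rightarrow> real" where
  "sample_pt a b N i = a + real i * mesh a b N"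

definition hole_indices :: "real \<Rightarrow> real \<Rightarrow> real \<Rightarrow> real \<Rightarrow> nat \<Rightarrow> nat set" where
  "hole_indices a b c d N = {i. i \<le> N \<and> c < sample_pt a b N i \<and> sample_pt a b N i < d}"

definition first_index :: "real \<Rightarrow> real \<Rightarrow> real \<Rightarrow> real \<Rightarrow> nat \<Rightarrow> nat" where
  "first_index a b c d N = Min (hole_indices a b c d N)"

definition last_index :: "real \<Rightarrow> real \<Rightarrow> real \<Rightarrow> real \<Rightarrow> nat \<Rightarrow> nat" where
  "last_index a b c d N = Max (hole_indices a b c d N)"

(* Nonemptiness is required because Min and Max are unspecified on the empty set. *)
definition enough_samples :: "nat \<Rightarrow> real \<Rightarrow> real \<Rightarrow> real \<Rightarrow> real \<Rightarrow> nat \<Rightarrow> bool" where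
  "enough_samples k a b c d N \<longleftrightarrow>
     N > 0 \<and> hole_indices a b c d N \<noteq> {} \<and>
     last_index a b c d N > first_index a b c d N + 2 * k"

(* For coarse meshes some of the nodes g (x_i), h (x_i) may coincide; then the description need
   not determine a polynomial and the value is unspecified. *)
definition reflected_poly ::
    "nat \<Rightarrow> (real \<Rightarrow> real) \<Rightarrow> (real \<Rightarrow> real) \<Rightarrow> real \<Rightarrow> real \<Rightarrow> real \<Rightarrow> real \<Rightarrow> nat \<Rightarrow> real poly" where
  "reflected_poly k g h a b c d N =
     (THE p. degree p \<le> 2 * k - 1 \<and>
        (\<forall>i \<in> {first_index a b c d N ..< first_index a b c d N + k}.
           poly p (g (sample_pt a b N i)) = sample_pt a b N i \<and>
           poly p (h (sample_pt a b N i)) = sample_pt a b N i))"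

definition search_interval ::
    "nat \<Rightarrow> (real \<Rightarrow> real) \<Rightarrow> (real \<Rightarrow> real) \<Rightarrow> real \<Rightarrow> real \<Rightarrow> real \<Rightarrow> real \<Rightarrow> nat \<Rightarrow> real set" where
  "search_interval k g h a b c d N =
     {g (sample_pt a b N (first_index a b c d N + k - 1)) ..
      h (sample_pt a b N (first_index a b c d N + k - 1))}"

end

theory Submission
  imports Defs
begin

text \<open>
  At its leftmost point the curve has a vertical tangent, so near it \<open>\<Gamma>\<close> is the graph
  \<open>x = \<phi>(y)\<close> of a function of class \<open>C\<close> of order \<open>2k\<close>, with minimum \<open>c\<close> at \<open>h c\<close> and, the
  curvature being nonzero, with \<open>\<phi>'' \<ge> m > 0\<close>.  By quadratic growth all \<open>2k\<close> nodes lie within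
  \<open>r = O(\<Delta> powr (1/2))\<close> of \<open>h c\<close>.  The error \<open>\<phi> - p\<close> vanishes at these nodes, so iterating
  Rolle's theorem gives \<open>\<bar>\<phi> - p\<bar> = O(r ^ (2k))\<close> and \<open>\<bar>\<phi>' - p'\<bar> = O(r ^ (2k - 1))\<close>.  Comparing
  minimal values bounds the first coordinate.  For the second one, at a minimum point \<open>y\<close> of \<open>p\<close>
  the sign of \<open>p' y\<close> is favourable even if \<open>y\<close> is an end of the search interval, so
  \<open>m * \<bar>y - h c\<bar> \<le> \<bar>\<phi>' y\<bar> \<le> \<bar>\<phi>' y - p' y\<bar>\<close>.
\<close>

section \<open>Functions of class \<open>C\<close> of order \<open>n\<close>\<close>

text \<open>The derivative is quantified existentially, so closure properties follow by induction
  with an explicit witness at each order. Derivatives are taken in the whole line, also at points of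
  which \<open>S\<close> is no neighbourhood.\<close>

primrec Ck_on :: "nat \<Rightarrow> (real \<Rightarrow> real) \<Rightarrow> real set \<Rightarrow> bool" where
  "Ck_on 0 f S \<longleftrightarrow> continuous_on S f"
| "Ck_on (Suc n) f S \<longleftrightarrow>
     (\<exists>f'. (\<forall>t\<in>S. (f has_real_derivative f' t) (at t)) \<and> Ck_on n f' S)"

lemma Ck_on_SucD: "Ck_on (Suc n) f S \<Longrightarrow> Ck_on n f S"
proof (induction n arbitrary: f)
  case 0
  then show ?case
    by (auto intro!: continuous_at_imp_continuous_on intro: DERIV_isCont)
next
  case (Suc n)
  then show ?case by (metis Ck_on.simps(2))
qed

lemma Ck_on_antimono: "Ck_on n f S \<Longrightarrow> m \<le> n \<Longrightarrow> Ck_on m f S"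
  by (induction n rule: nat_induct) (auto simp: le_Suc_eq dest: Ck_on_SucD simp del: Ck_on.simps)

lemma Ck_on_add: "Ck_on n f S \<Longrightarrow> Ck_on n g S \<Longrightarrow> Ck_on n (\<lambda>t. f t + g t) S"
proof (induction n arbitrary: f g)
  case 0
  then show ?case by (simp add: continuous_on_add)
next
  case (Suc n)
  from Suc.prems obtain f' g' where
    "\<forall>t\<in>S. (f has_real_derivative f' t) (at t)" "Ck_on n f' S"
    "\<forall>t\<in>S. (g has_real_derivative g' t) (at t)" "Ck_on n g' S"
    by auto
  then show ?case
    by (auto intro!: exI[of _ "\<lambda>t. f' t + g' t"] Suc.IH DERIV_add)
qed

lemma Ck_on_minus: "Ck_on n f S \<Longrightarrow> Ck_on n (\<lambda>t. - f t) S"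
proof (induction n arbitrary: f)
  case 0
  then show ?case by (simp add: continuous_on_minus)
next
  case (Suc n)
  from Suc.prems obtain f' where
    "\<forall>t\<in>S. (f has_real_derivative f' t) (at t)" "Ck_on n f' S"
    by auto
  then show ?case
    by (auto intro!: exI[of _ "\<lambda>t. - f' t"] Suc.IH DERIV_minus)
qed

lemma Ck_on_mult: "Ck_on n f S \<Longrightarrow> Ck_on n g S \<Longrightarrow> Ck_on n (\<lambda>t. f t * g t) S"
proof (induction n arbitrary: f g)
  case 0
  then show ?case by (simp add: continuous_on_mult)
next
  case (Suc n)
  from Suc.prems obtain f' g' where *:
    "\<forall>t\<in>S. (f has_real_derivative f' t) (at t)" "Ck_on n f' S"
    "\<forall>t\<in>S. (g has_real_derivative g' t) (at t)" "Ck_on n g' S"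
    by auto
  have "Ck_on n (\<lambda>t. f' t * g t + g' t * f t) S"
    using * Suc.prems by (intro Ck_on_add Suc.IH) (auto dest: Ck_on_SucD simp del: Ck_on.simps)
  with * show ?case
    by (auto intro!: exI[of _ "\<lambda>t. f' t * g t + g' t * f t"] DERIV_mult)
qed

lemma Ck_on_inverse:
  "Ck_on n f S \<Longrightarrow> (\<And>t. t \<in> S \<Longrightarrow> f t \<noteq> 0) \<Longrightarrow> Ck_on n (\<lambda>t. inverse (f t)) S"
proof (induction n)
  case 0
  then show ?case by (auto intro: continuous_on_inverse)
next
  case (Suc n)
  from Suc.prems obtain f' where *:
    "\<forall>t\<in>S. (f has_real_derivative f' t) (at t)" "Ck_on n f' S"
    by auto
  \<comment> \<open>The derivative of the reciprocal contains the reciprocal again; lowering the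
    order of \<open>f\<close> by one makes the induction hypothesis apply to it.\<close>
  have inv: "Ck_on n (\<lambda>t. inverse (f t)) S"
    using Suc by (auto dest: Ck_on_SucD simp del: Ck_on.simps)
  have "Ck_on n (\<lambda>t. - (inverse (f t) * f' t * inverse (f t))) S"
    by (intro Ck_on_minus Ck_on_mult inv *)
  with * Suc.prems(2) show ?case
    by (auto intro!: exI[of _ "\<lambda>t. - (inverse (f t) * f' t * inverse (f t))"] DERIV_inverse')
qed

text \<open>Links the recursive form, suited to closure properties, with a full sequence of
  derivatives, suited to Taylor's formula and iterated Rolle.\<close>

lemma Ck_on_derivatives:
  "Ck_on n f S \<longleftrightarrow>
     (\<exists>F. F 0 = f \<and> (\<forall>i<n. \<forall>t\<in>S. (F i has_real_derivative F (Suc i) t) (at t)) \<and>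
          continuous_on S (F n))"
proof (induction n arbitrary: f)
  case 0
  then show ?case by auto
next
  case (Suc n)
  show ?case
  proof
    assume "Ck_on (Suc n) f S"
    then obtain f' where f': "\<forall>t\<in>S. (f has_real_derivative f' t) (at t)" "Ck_on n f' S"
      by auto
    then obtain F where F: "F 0 = f'"
      "\<forall>i<n. \<forall>t\<in>S. (F i has_real_derivative F (Suc i) t) (at t)" "continuous_on S (F n)"
      using Suc by auto
    define H where "H = case_nat f F"
    have "\<forall>i<Suc n. \<forall>t\<in>S. (H i has_real_derivative H (Suc i) t) (at t)"
      using f' F by (auto simp: H_def less_Suc_eq_0_disj)
    then show "\<exists>F. F 0 = f \<and> (\<forall>i<Suc n. \<forall>t\<in>S. (F i has_real_derivative F (Suc i) t) (at t)) \<and>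
          continuous_on S (F (Suc n))"
      using F(3) by (intro exI[of _ H]) (auto simp: H_def)
  next
    assume "\<exists>F. F 0 = f \<and> (\<forall>i<Suc n. \<forall>t\<in>S. (F i has_real_derivative F (Suc i) t) (at t)) \<and>
          continuous_on S (F (Suc n))"
    then obtain F where F: "F 0 = f"
      "\<forall>i<Suc n. \<forall>t\<in>S. (F i has_real_derivative F (Suc i) t) (at t)" "continuous_on S (F (Suc n))"
      by auto
    have "Ck_on n (F 1) S"
      using F by (subst Suc, intro exI[of _ "\<lambda>i. F (Suc i)"]) auto
    with F show "Ck_on (Suc n) f S"
      by (auto intro!: exI[of _ "F 1"])
  qed
qed

text \<open>The derivative of \<open>f \<circ> Y\<^sup>-\<^sup>1\<close> is \<open>(f' / Y') \<circ> Y\<^sup>-\<^sup>1\<close>, again of this form.\<close>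
lemma Ck_on_compose_inverse:
  assumes "open S" and Y: "\<And>t. t \<in> S \<Longrightarrow> (Y has_real_derivative Y' t) (at t)"
    and nz: "\<And>t. t \<in> S \<Longrightarrow> Y' t \<noteq> 0" and Z: "\<And>t. t \<in> S \<Longrightarrow> Z (Y t) = t"
  shows "Ck_on n f S \<Longrightarrow> Ck_on (n - 1) Y' S \<Longrightarrow> Ck_on n (\<lambda>y. f (Z y)) (Y ` S)"
proof -
  \<comment> \<open>As \<open>Z\<close> is a given left inverse on the open set \<open>S\<close>,
    continuity of \<open>Y\<close> on \<open>S\<close> and \<open>Y' t\<close> being nonzero
    suffice.\<close>
  have dZ: "(Z has_real_derivative inverse (Y' t)) (at (Y t))" if "t \<in> S" for t
    unfolding has_field_derivative_def
  proof (rule has_derivative_inverse_strong[where S = S and f = Y and x = t and f' = "\<lambda>s. Y' t * s"])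
    show "(Y has_derivative (\<lambda>s. Y' t * s)) (at t)"
      using Y that by (simp add: has_field_derivative_def)
    show "continuous_on S Y"
      using Y by (auto intro!: continuous_at_imp_continuous_on intro: DERIV_isCont)
  qed (use that assms in \<open>auto simp: fun_eq_iff\<close>)
  show "Ck_on n f S \<Longrightarrow> Ck_on (n - 1) Y' S \<Longrightarrow> Ck_on n (\<lambda>y. f (Z y)) (Y ` S)"
  proof (induction n arbitrary: f)
    case 0
    have "continuous_on (Y ` S) Z"
      using dZ by (auto intro!: continuous_at_imp_continuous_on intro: DERIV_isCont)
    moreover have "Z ` Y ` S \<subseteq> S" using Z by auto
    ultimately show ?case
      using 0 by (auto intro: continuous_on_compose2)
  next
    case (Suc n)
    then obtain f' where f': "\<forall>t\<in>S. (f has_real_derivative f' t) (at t)" "Ck_on n f' S"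
      by auto
    have "Ck_on n (\<lambda>y. f' (Z y) * inverse (Y' (Z y))) (Y ` S)"
      using Suc.prems(2) f'(2)
      by (intro Suc.IH Ck_on_mult Ck_on_inverse nz) (auto elim: Ck_on_antimono)
    moreover have "((\<lambda>y. f (Z y)) has_real_derivative f' (Z y) * inverse (Y' (Z y))) (at y)"
      if "y \<in> Y ` S" for y
      using that f' dZ by (auto intro!: DERIV_chain2[where f = f and g = Z] simp: Z)
    ultimately show ?case
      by (auto intro!: exI[of _ "\<lambda>y. f' (Z y) * inverse (Y' (Z y))"])
  qed
qed

section \<open>Rolle's theorem and interpolation\<close>

text \<open>Zeros are added in increasing order. The last conclusion keeps the old zeros of
  \<open>f'\<close> at or below the old maximum, so the new one, found beyond that maximum, is
  distinct from them.\<close>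

lemma Rolle_card:
  fixes f :: "real \<Rightarrow> real"
  assumes "finite Z" "Z \<subseteq> {u..v}" "\<And>t. t \<in> {u..v} \<Longrightarrow> (f has_real_derivative f' t) (at t)"
    and "\<And>z. z \<in> Z \<Longrightarrow> f z = 0"
  shows "\<exists>Z'. finite Z' \<and> card Z' = card Z - 1 \<and> Z' \<subseteq> {u..v} \<and> (\<forall>z\<in>Z'. f' z = 0) \<and>
    (\<forall>z\<in>Z'. \<exists>a\<in>Z. z \<le> a)"
  using assms(1,2,4)
proof (induction Z rule: finite_linorder_max_induct)
  case empty
  then show ?case by (intro exI[of _ "{}"]) auto
next
  case (insert b A)
  then obtain Z' where Z': "finite Z'" "card Z' = card A - 1" "Z' \<subseteq> {u..v}"
      "\<forall>z\<in>Z'. f' z = 0" "\<forall>z\<in>Z'. \<exists>a\<in>A. z \<le> a" by auto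
  show ?case
  proof (cases "A = {}")
    case True
    then show ?thesis by (intro exI[of _ "{}"]) auto
  next
    case False
    define a where "a = Max A"
    have a: "a \<in> A" "a < b" "\<And>x. x \<in> A \<Longrightarrow> x \<le> a"
      using False insert by (auto simp: a_def)
    have sub: "{a..b} \<subseteq> {u..v}" using a insert by auto
    have "\<exists>z. a < z \<and> z < b \<and> f' z = 0"
    proof (rule Rolle_deriv[where f = f and f' = "\<lambda>t s. f' t * s", elim_format])
      show "a < b" "f a = f b" using a insert by auto
      show "continuous_on {a..b} f"
        using sub assms(3) by (meson DERIV_isCont continuous_at_imp_continuous_on subsetD)
      show "(f has_derivative (\<lambda>s. f' t * s)) (at t)" if "a < t" "t < b" for t
      proof -
        have "t \<in> {u..v}" using sub that by auto
        then show ?thesis using assms(3) by (simp add: has_field_derivative_def)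
      qed
      assume "\<exists>z>a. z < b \<and> (\<lambda>s. f' z * s) = (\<lambda>v. 0)"
      then show ?thesis by (metis mult.right_neutral)
    qed
    then obtain z where z: "a < z" "z < b" "f' z = 0" by auto
    have "z \<notin> Z'" using Z'(5) a z by fastforce
    moreover have "b \<notin> A" using insert by auto
    moreover have "card A > 0" using False insert.hyps by (simp add: card_gt_0_iff)
    ultimately show ?thesis
      using Z' z sub insert.hyps by (intro exI[of _ "insert z Z'"]) auto
  qed
qed

text \<open>Rolle leaves the derivative one zero fewer, so induction bounds it by one power less;
  the mean value inequality from any zero of \<open>F 0\<close> supplies the missing factor
  \<open>v - u\<close>.\<close>

lemma zeros_bound:
  fixes F :: "nat \<Rightarrow> real \<Rightarrow> real"
  assumes "finite Z" "card Z = n" "Z \<subseteq> {u..v}" "\<And>z. z \<in> Z \<Longrightarrow> F 0 z = 0"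
    and "\<And>i t. i < n \<Longrightarrow> t \<in> {u..v} \<Longrightarrow> (F i has_real_derivative F (Suc i) t) (at t)"
    and "\<And>t. t \<in> {u..v} \<Longrightarrow> \<bar>F n t\<bar> \<le> M" and "t \<in> {u..v}"
  shows "\<bar>F 0 t\<bar> \<le> M * (v - u) ^ n"
  using assms
proof (induction n arbitrary: F Z t)
  case 0
  then show ?case by auto
next
  case (Suc n)
  obtain Z' where Z': "finite Z'" "card Z' = card Z - 1" "Z' \<subseteq> {u..v}" "\<forall>z\<in>Z'. F 1 z = 0"
    using Rolle_card[of Z u v "F 0" "F 1"] Suc.prems by auto
  have bd: "\<bar>F (Suc 0) s\<bar> \<le> M * (v - u) ^ n" if "s \<in> {u..v}" for s
    using Suc.IH[of Z' "\<lambda>i. F (Suc i)" s] Suc.prems Z' that by auto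
  have "Z \<noteq> {}" using Suc.prems by auto
  then obtain z where z: "z \<in> Z" by auto
  have "norm (F 0 t - F 0 z) \<le> (M * (v - u) ^ n) * norm (t - z)"
  proof (rule field_differentiable_bound[where S = "{u..v}" and f' = "F (Suc 0)"])
    show "(F 0 has_real_derivative F (Suc 0) s) (at s within {u..v})" if "s \<in> {u..v}" for s
      using Suc.prems(5) that by (auto intro: has_field_derivative_at_within)
  qed (use bd z Suc.prems in auto)
  also have "\<dots> \<le> (M * (v - u) ^ n) * (v - u)"
  proof (rule mult_left_mono)
    show "norm (t - z) \<le> v - u" using z Suc.prems(3,7) by (fastforce simp: abs_le_iff)
    show "0 \<le> M * (v - u) ^ n" using bd[OF Suc.prems(7)] by linarith
  qed
  finally show ?case using z Suc.prems by (simp add: mult_ac)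
qed

text \<open>Newton's construction: a multiple of the product vanishing at the old nodes corrects the
  value at the new one.\<close>

lemma interpolation_exists:
  fixes f :: "'a::field \<Rightarrow> 'a"
  assumes "finite A"
  shows "\<exists>p. degree p \<le> card A - 1 \<and> (\<forall>x\<in>A. poly p x = f x)"
  using assms
proof (induction A)
  case empty
  then show ?case by (intro exI[of _ 0]) auto
next
  case (insert a A)
  then obtain p where p: "degree p \<le> card A - 1" "\<forall>x\<in>A. poly p x = f x" by auto
  define w where "w = (\<Prod>x\<in>A. [:- x, 1:])"
  have w: "poly w x = (\<Prod>y\<in>A. x - y)" for x by (simp add: w_def poly_prod)
  have "poly w a \<noteq> 0" using insert by (auto simp: w)
  moreover have "poly w x = 0" if "x \<in> A" for x using that insert by (auto simp: w)
  moreover have "degree w \<le> card A"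
    unfolding w_def using degree_prod_sum_le[of A "\<lambda>x. [:- x, 1:]"] insert by simp
  then have "degree (p + smult ((f a - poly p a) / poly w a) w) \<le> card A"
    using p by (intro degree_add_le) (auto intro: order_trans[OF degree_smult_le])
  ultimately show ?case
    using p insert by (intro exI[of _ "p + smult ((f a - poly p a) / poly w a) w"]) auto
qed

lemma interpolation_unique:
  fixes p q :: "'a::idom poly"
  assumes "finite A" "degree p < card A" "degree q < card A" "\<And>x. x \<in> A \<Longrightarrow> poly p x = poly q x"
  shows "p = q"
proof (rule ccontr)
  assume "p \<noteq> q"
  then have nz: "p - q \<noteq> 0" by simp
  have "card A \<le> card {x. poly (p - q) x = 0}"
    using assms by (intro card_mono poly_roots_finite nz) auto
  also have "\<dots> \<le> degree (p - q)" by (rule card_poly_roots_bound[OF nz])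
  also have "\<dots> < card A" using assms by (intro degree_diff_less)
  finally show False by simp
qed

section \<open>The curve near its leftmost point\<close>

lemma C_differentiable_component:
  assumes "C_differentiable r \<gamma>" "bounded_linear (L :: 'a::real_normed_vector \<Rightarrow> real)" "i < r"
  shows "((\<lambda>t. L ((vderiv ^^ i) \<gamma> t)) has_real_derivative L ((vderiv ^^ Suc i) \<gamma> t)) (at t)"
proof -
  have "(vderiv ^^ i) \<gamma> differentiable (at t)"
    using assms by (auto simp: C_differentiable_def)
  then have "((vderiv ^^ i) \<gamma> has_vector_derivative (vderiv ^^ Suc i) \<gamma> t) (at t)"
    by (simp add: vector_derivative_works vderiv_def)
  then show ?thesis
    using bounded_linear.has_vector_derivative[OF assms(2)]
    by (simp add: has_real_derivative_iff_has_vector_derivative)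
qed

lemma C_differentiable_imp_Ck_on:
  assumes "C_differentiable r \<gamma>" "bounded_linear (L :: 'a::real_normed_vector \<Rightarrow> real)" "i \<le> r"
  shows "Ck_on (r - i) (\<lambda>t. L ((vderiv ^^ i) \<gamma> t)) S"
  unfolding Ck_on_derivatives
proof (intro exI conjI allI ballI impI)
  show "(\<lambda>t. L ((vderiv ^^ (i + 0)) \<gamma> t)) = (\<lambda>t. L ((vderiv ^^ i) \<gamma> t))" by simp
  show "((\<lambda>t. L ((vderiv ^^ (i + j)) \<gamma> t)) has_real_derivative L ((vderiv ^^ (i + Suc j)) \<gamma> t)) (at t)"
    if "j < r - i" for j t
    using C_differentiable_component[OF assms(1,2), of "i + j"] that by simp
  have "continuous_on S ((vderiv ^^ r) \<gamma>)"
    using assms(1) by (auto simp: C_differentiable_def intro: continuous_on_subset)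
  then show "continuous_on S (\<lambda>t. L ((vderiv ^^ (i + (r - i))) \<gamma> t))"
    using assms(2,3) by (simp add: bounded_linear.continuous_on)
qed

section \<open>Periodic simple closed curves\<close>

lemma periodic_int:
  fixes \<gamma> :: "real \<Rightarrow> 'a"
  assumes "\<And>t. \<gamma> (t + 1) = \<gamma> t"
  shows "\<gamma> (t + of_int n) = \<gamma> t"
proof (induction n rule: int_induct[where k = 0])
  case (step1 i)
  then show ?case using assms[of "t + of_int i"] by (simp add: algebra_simps)
next
  case (step2 i)
  then show ?case using assms[of "t + of_int (i - 1)"] by (simp add: algebra_simps)
qed simp

text \<open>Fractional parts move both parameters into the half-open unit interval, where the
  permitted coincidence of the two ends of a simple path cannot occur.\<close>

lemma periodic_simple_path_eq:
  assumes "\<And>t. \<gamma> (t + 1) = \<gamma> t" "simple_path \<gamma>" "\<gamma> s = \<gamma> t"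
  shows "s - t \<in> \<int>"
proof -
  have fr: "\<gamma> (frac u) = \<gamma> u" for u
    using periodic_int[of \<gamma>, OF assms(1), of u "- \<lfloor>u\<rfloor>"] by (simp add: frac_def)
  have "frac s = frac t"
    using assms(2,3) fr[of s] fr[of t] frac_ge_0[of s] frac_ge_0[of t] frac_lt_1[of s] frac_lt_1[of t]
    unfolding simple_path_def loop_free_def by (metis atLeastAtMost_iff less_eq_real_def less_irrefl)
  then have "s - t = of_int (\<lfloor>s\<rfloor> - \<lfloor>t\<rfloor>)" by (simp add: frac_def)
  then show ?thesis by (metis Ints_of_int)
qed

lemma periodic_in_path_image:
  assumes "\<And>t. \<gamma> (t + 1) = \<gamma> t"
  shows "\<gamma> t \<in> path_image \<gamma>"
proof -
  have "\<gamma> (frac t) = \<gamma> t"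
    using periodic_int[of \<gamma>, OF assms(1), of t "- \<lfloor>t\<rfloor>"] by (simp add: frac_def)
  then show ?thesis
    unfolding path_image_def using frac_ge_0[of t] frac_lt_1[of t]
    by (metis atLeastAtMost_iff imageI less_eq_real_def)
qed

lemma periodic_representative:
  fixes \<gamma> :: "real \<Rightarrow> 'a"
  assumes "\<And>t. \<gamma> (t + 1) = \<gamma> t"
  obtains s where "t0 \<le> s" "s < t0 + 1" "\<gamma> s = \<gamma> t"
proof
  show "t0 \<le> t0 + frac (t - t0)" "t0 + frac (t - t0) < t0 + 1"
    by (auto simp: frac_lt_1)
  show "\<gamma> (t0 + frac (t - t0)) = \<gamma> t"
    using periodic_int[of \<gamma>, OF assms, of t "- \<lfloor>t - t0\<rfloor>"] by (simp add: frac_def)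
qed

text \<open>On the compact rest of one period the first coordinate attains a minimum, which exceeds
  \<open>c\<close>; the excess serves as \<open>\<eta>\<close>.\<close>

lemma points_near_leftmost:
  fixes \<gamma> :: "real \<Rightarrow> real \<times> real"
  assumes per: "\<And>t. \<gamma> (t + 1) = \<gamma> t" and simple: "simple_path \<gamma>" and cont: "continuous_on UNIV \<gamma>"
    and left: "\<And>t. c \<le> fst (\<gamma> t)" "\<And>t. fst (\<gamma> t) = c \<Longrightarrow> \<gamma> t = \<gamma> t0"
    and "\<epsilon> > 0"
  obtains \<eta> where "\<eta> > 0" "\<And>q. q \<in> path_image \<gamma> \<Longrightarrow> fst q < c + \<eta> \<Longrightarrow> q \<in> \<gamma> ` ball t0 \<epsilon>"
proof -
  \<comment> \<open>The cap keeps the remaining parameter interval nonempty; as it lies strictly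
    between \<open>t0\<close> and \<open>t0 + 1\<close>, no integer translate of \<open>t0\<close>
    is in it.\<close>
  define e where "e = min \<epsilon> (1/4)"
  have e: "e > 0" "e \<le> 1/4" "e \<le> \<epsilon>" using \<open>\<epsilon> > 0\<close> by (auto simp: e_def)
  have "continuous_on {t0 + e..t0 + 1 - e} (\<lambda>t. fst (\<gamma> t))"
    by (intro continuous_intros continuous_on_subset[OF cont]) auto
  then obtain m where m: "m \<in> {t0 + e..t0 + 1 - e}"
      "\<And>t. t \<in> {t0 + e..t0 + 1 - e} \<Longrightarrow> fst (\<gamma> m) \<le> fst (\<gamma> t)"
    using continuous_attains_inf[of "{t0 + e..t0 + 1 - e}" "\<lambda>t. fst (\<gamma> t)"] e by fastforce
  have "fst (\<gamma> m) \<noteq> c"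
  proof
    assume "fst (\<gamma> m) = c"
    then have "m - t0 \<in> \<int>"
      using left(2) periodic_simple_path_eq[of \<gamma>, OF per simple] by blast
    then obtain n where "m - t0 = of_int n" by (auto elim: Ints_cases)
    then have "0 < (of_int n :: real)" "of_int n < (1::real)" using m(1) e by auto
    then show False by auto
  qed
  then have pos: "fst (\<gamma> m) - c > 0" using left(1)[of m] by auto
  show ?thesis
  proof (rule that[OF pos])
    fix q assume q: "q \<in> path_image \<gamma>" "fst q < c + (fst (\<gamma> m) - c)"
    then obtain t where "q = \<gamma> t" by (auto simp: path_image_def)
    then obtain s where s: "t0 \<le> s" "s < t0 + 1" "\<gamma> s = q"
      using periodic_representative[of \<gamma>, OF per] by metis
    have "\<not> s \<in> {t0 + e..t0 + 1 - e}" using m(2)[of s] s q(2) by auto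
    then consider "s < t0 + e" | "s > t0 + 1 - e" by fastforce
    then show "q \<in> \<gamma> ` ball t0 \<epsilon>"
    proof cases
      case 1
      then show ?thesis using s e by (intro image_eqI[of _ _ s]) (auto simp: dist_real_def)
    next
      \<comment> \<open>Near the end of the period, the parameter is shifted back by one
        period.\<close>
      case 2
      then show ?thesis using s e per[of "s - 1"]
        by (intro image_eqI[of _ _ "s - 1"]) (auto simp: dist_real_def)
    qed
  qed
qed

text \<open>Near the leftmost point the height is a local parameter, so composing the first
  coordinate with its inverse gives the graph function \<open>F 0\<close>. The last conclusion is
  global: every boundary point with abscissa close to \<open>c\<close> lies on this one
  graph.\<close>

lemma local_graph:
  fixes \<gamma> :: "real \<Rightarrow> real \<times> real"
  assumes k: "k \<ge> 1" and cd: "c < d" and gh: "g c = h c"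
    and boundary: "\<Gamma> = hole_boundary g h c d"
    and smooth: "closed_curve_param (2 * k) \<gamma> \<Gamma>"
    and curv: "\<And>t. \<gamma> t = (c, h c) \<Longrightarrow> curvature \<gamma> t \<noteq> 0"
  obtains F :: "nat \<Rightarrow> real \<Rightarrow> real" and \<delta> m M \<eta> where
    "\<delta> > 0" "m > 0" "\<eta> > 0" "F 0 (h c) = c" "F 1 (h c) = 0"
    "\<And>i y. i < 2 * k \<Longrightarrow> \<bar>y - h c\<bar> < \<delta> \<Longrightarrow> (F i has_real_derivative F (Suc i) y) (at y)"
    "\<And>y. \<bar>y - h c\<bar> < \<delta> \<Longrightarrow> m \<le> F 2 y"
    "\<And>y. \<bar>y - h c\<bar> < \<delta> \<Longrightarrow> \<bar>F (2 * k) y\<bar> \<le> M"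
    "\<And>q. q \<in> \<Gamma> \<Longrightarrow> fst q < c + \<eta> \<Longrightarrow> \<bar>snd q - h c\<bar> < \<delta> \<and> F 0 (snd q) = fst q"
proof -
  define X where "X i t = fst ((vderiv ^^ i) \<gamma> t)" for i t
  define Y where "Y i t = snd ((vderiv ^^ i) \<gamma> t)" for i t
  from smooth have C: "C_differentiable (2 * k) \<gamma>" and per: "\<And>t. \<gamma> (t + 1) = \<gamma> t"
    and simple: "simple_path \<gamma>" and img: "path_image \<gamma> = \<Gamma>"
    by (auto simp: closed_curve_param_def)
  have dX: "(X i has_real_derivative X (Suc i) t) (at t)" if "i < 2 * k" for i t
    unfolding X_def by (rule C_differentiable_component[OF C bounded_linear_fst that])
  have dY: "(Y i has_real_derivative Y (Suc i) t) (at t)" if "i < 2 * k" for i t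
    unfolding Y_def by (rule C_differentiable_component[OF C bounded_linear_snd that])
  have CX: "Ck_on (2 * k) (X 0) S" and CY: "Ck_on (2 * k - 1) (Y 1) S" for S
    using C_differentiable_imp_Ck_on[OF C bounded_linear_fst, of 0 S]
      C_differentiable_imp_Ck_on[OF C bounded_linear_snd, of 1 S] k
    by (auto simp: X_def[abs_def] Y_def[abs_def])
  have XY0: "\<gamma> t = (X 0 t, Y 0 t)" for t by (simp add: X_def Y_def)
  have on_\<Gamma>: "\<gamma> t \<in> \<Gamma>" for t using periodic_in_path_image[of \<gamma>, OF per] img by auto
  then have left: "c \<le> fst (\<gamma> t)" "fst (\<gamma> t) = c \<Longrightarrow> \<gamma> t = (c, h c)" for t
    using on_\<Gamma>[of t] gh by (cases "\<gamma> t"; auto simp: boundary hole_boundary_def)+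
  have "(c, h c) \<in> path_image \<gamma>" using img boundary cd by (auto simp: hole_boundary_def)
  then obtain t0 where t0: "\<gamma> t0 = (c, h c)" by (auto simp: path_image_def)
  then have XY_t0: "X 0 t0 = c" "Y 0 t0 = h c" by (auto simp: X_def Y_def)
  have X1: "X 1 t0 = 0"
    using dX[of 0 t0] k left(1) XY_t0 by (intro DERIV_local_min[of "X 0" _ t0 1]) (auto simp: X_def)
  \<comment> \<open>With \<open>X 1 t0 = 0\<close> the numerator of the curvature is minus the
    product of \<open>Y 1 t0\<close> and \<open>X 2 t0\<close>.\<close>
  have nz: "Y 1 t0 \<noteq> 0" "X 2 t0 \<noteq> 0"
    using curv[OF t0] X1 by (auto simp: curvature_def X_def Y_def numeral_2_eq_2)

  have "isCont (Y 1) t0" using dY[of 1 t0] k by (auto intro: DERIV_isCont)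
  then obtain \<epsilon> where \<epsilon>: "\<epsilon> > 0" "\<And>t. dist t0 t < \<epsilon> \<Longrightarrow> Y 1 t \<noteq> 0"
    using continuous_at_avoid[of t0 "Y 1" 0] nz by auto
  define S where "S = ball t0 \<epsilon>"
  have S: "open S" "t0 \<in> S" "\<And>t. t \<in> S \<Longrightarrow> Y 1 t \<noteq> 0" using \<epsilon> by (auto simp: S_def)
  have dY0: "(Y 0 has_real_derivative Y 1 t) (at t)" for t using dY[of 0 t] k by simp
  have neq: "Y 0 s \<noteq> Y 0 t" if st: "s \<in> S" "t \<in> S" "s < t" for s t
  proof
    assume "Y 0 s = Y 0 t"
    moreover obtain z where "s < z" "z < t" "Y 0 t - Y 0 s = (t - s) * Y 1 z"
      using MVT2[OF st(3), of "Y 0" "Y 1"] dY0 by auto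
    moreover have "z \<in> S" using calculation st by (auto simp: S_def dist_real_def)
    ultimately show False using S(3) by auto
  qed
  then have inj: "inj_on (Y 0) S"
    by (intro linorder_inj_onI) auto
  have open_W: "open (Y 0 ` S)"
    using dY0 S inj
    by (intro invariance_of_domain continuous_at_imp_continuous_on) (auto intro: DERIV_isCont)
  define Z where "Z = inv_into S (Y 0)"
  have Z: "Z (Y 0 t) = t" if "t \<in> S" for t using inj that by (simp add: Z_def)
  have "Ck_on (2 * k) (\<lambda>y. X 0 (Z y)) (Y 0 ` S)"
    using S Z dY0 CX CY by (intro Ck_on_compose_inverse[where Y' = "Y 1"]) auto
  then obtain F where F0: "F 0 = (\<lambda>y. X 0 (Z y))"
    and dF: "\<And>i y. i < 2 * k \<Longrightarrow> y \<in> Y 0 ` S \<Longrightarrow> (F i has_real_derivative F (Suc i) y) (at y)"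
    and contF: "continuous_on (Y 0 ` S) (F (2 * k))"
    unfolding Ck_on_derivatives by auto
  have FY: "F 0 (Y 0 t) = X 0 t" if "t \<in> S" for t using Z[OF that] by (simp add: F0)
  have W: "h c \<in> Y 0 ` S" using S(2) XY_t0 by force
  have F0c: "F 0 (h c) = c" using FY[OF S(2)] XY_t0 by simp
  obtain \<delta>1 where \<delta>1: "\<delta>1 > 0" "ball (h c) \<delta>1 \<subseteq> Y 0 ` S"
    using open_W W open_contains_ball by blast
  \<comment> \<open>This holds for every real \<open>y\<close>: outside the image of
    \<open>S\<close> the value of \<open>Z\<close> is unspecified, but \<open>F 0 y\<close> is still
    the abscissa of a curve point.\<close>
  have F0_ge: "c \<le> F 0 y" for y using left(1) by (simp add: F0 X_def)
  have F1: "F 1 (h c) = 0"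
    using dF[of 0 "h c"] W k F0_ge F0c by (intro DERIV_local_min[of "F 0" _ "h c" 1]) auto
  have X1_eq: "X 1 t = F 1 (Y 0 t) * Y 1 t" if "t \<in> S" for t
  proof -
    have "((\<lambda>t. F 0 (Y 0 t)) has_real_derivative F 1 (Y 0 t) * Y 1 t) (at t)"
      using dF[of 0 "Y 0 t"] that k dY0 by (intro DERIV_chain2[where f = "F 0"]) auto
    then have "(X 0 has_real_derivative F 1 (Y 0 t) * Y 1 t) (at t)"
      using S(1) that FY by (rule has_field_derivative_transform_within_open) auto
    then show ?thesis using dX[of 0 t] k DERIV_unique by fastforce
  qed
  \<comment> \<open>Second differentiation of \<open>X 0\<close> as a composition; at
    \<open>t0\<close> the term with \<open>F 1\<close> vanishes, so \<open>F 2 (h c)\<close>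
    inherits being nonzero from \<open>X 2 t0\<close>.\<close>
  have "((\<lambda>t. F 1 (Y 0 t) * Y 1 t) has_real_derivative
      F 2 (Y 0 t0) * Y 1 t0 * Y 1 t0 + Y 2 t0 * F 1 (Y 0 t0)) (at t0)"
    using dF[of 1 "Y 0 t0"] dY[of 1 t0] S(2) k dY0[of t0]
    by (intro DERIV_mult DERIV_chain2[where f = "F 1"]) (auto simp: numeral_2_eq_2)
  then have "(X 1 has_real_derivative F 2 (h c) * Y 1 t0 * Y 1 t0) (at t0)"
    unfolding XY_t0 F1 mult_zero_right add_0_right
    by (rule has_field_derivative_transform_within_open[OF _ S(1,2)]) (rule X1_eq[symmetric])
  moreover have "(X 1 has_real_derivative X 2 t0) (at t0)"
    using dX[of 1 t0] k by (simp add: numeral_2_eq_2)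
  ultimately have F2_nz: "F 2 (h c) \<noteq> 0" using nz DERIV_unique by (metis mult_zero_left)
  have isCont_top: "isCont (F (2 * k)) (h c)"
    using contF open_W W continuous_on_eq_continuous_at by blast
  have isCont_2: "isCont (F 2) (h c)"
  \<comment> \<open>For \<open>k = 1\<close> the second derivative is the top one, known only to be
    continuous; otherwise it is differentiable.\<close>
  proof (cases "k = 1")
    case True
    then show ?thesis using isCont_top by simp
  next
    case False
    then show ?thesis using dF[of 2 "h c"] W k by (auto intro: DERIV_isCont)
  qed
  obtain \<delta>2 where \<delta>2: "\<delta>2 > 0" "\<And>y. \<bar>y - h c\<bar> < \<delta>2 \<Longrightarrow> \<bar>F 2 y - F 2 (h c)\<bar> < \<bar>F 2 (h c)\<bar> / 2"
    using isCont_2 F2_nz unfolding continuous_at_eps_delta dist_real_def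
    by (metis half_gt_zero zero_less_abs_iff)
  obtain \<delta>3 where \<delta>3: "\<delta>3 > 0" "\<And>y. \<bar>y - h c\<bar> < \<delta>3 \<Longrightarrow> \<bar>F (2 * k) y - F (2 * k) (h c)\<bar> < 1"
    using isCont_top unfolding continuous_at_eps_delta dist_real_def
    by (metis zero_less_one)
  define \<delta> where "\<delta> = min \<delta>1 (min \<delta>2 \<delta>3)"
  have \<delta>: "\<delta> > 0" "\<delta> \<le> \<delta>1" "\<delta> \<le> \<delta>2" "\<delta> \<le> \<delta>3" using \<delta>1 \<delta>2 \<delta>3 by (auto simp: \<delta>_def)
  have dF': "(F i has_real_derivative F (Suc i) y) (at y)" if "i < 2 * k" "\<bar>y - h c\<bar> < \<delta>" for i y
    using that \<delta> \<delta>1(2) by (intro dF) (auto simp: dist_real_def subset_iff)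
  \<comment> \<open>A negative value would, by Taylor's formula, push \<open>F 0\<close> below its
    lower bound \<open>c\<close> at a nearby point.\<close>
  have F2_pos: "F 2 (h c) > 0"
  proof (rule ccontr)
    assume "\<not> F 2 (h c) > 0"
    then have neg: "F 2 (h c) < 0" using F2_nz by simp
    define b where "b = h c + \<delta> / 2"
    obtain t where t: "h c < t" "t < b"
      "F 0 b = (\<Sum>m<2. F m (h c) / fact m * (b - h c) ^ m) + F 2 t / fact 2 * (b - h c)\<^sup>2"
      using Taylor_up[of 2 F "F 0" "h c" b "h c"] dF' k \<delta> by (auto simp: b_def)
    have "F 2 t < 0" using \<delta>2(2)[of t] t neg \<delta> by (auto simp: b_def)
    then have "F 0 b < c" using t(3) \<delta>(1) F0c F1
      by (auto simp: b_def lessThan_nat_numeral numeral_2_eq_2 mult_neg_pos)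
    then show False using F0_ge[of b] by simp
  qed
  have "isCont (Y 0) t0" using dY0 by (rule DERIV_isCont)
  then obtain \<epsilon>2 where \<epsilon>2: "\<epsilon>2 > 0" "\<And>t. dist t t0 < \<epsilon>2 \<Longrightarrow> \<bar>Y 0 t - h c\<bar> < \<delta>"
    using \<delta>(1) XY_t0 unfolding continuous_at_eps_delta by (metis dist_real_def)
  have cont: "continuous_on UNIV \<gamma>"
  proof -
    have "\<forall>t. \<gamma> differentiable (at t)"
      using C k unfolding C_differentiable_def by (metis funpow_0 mult_pos_pos zero_less_numeral less_le_trans zero_less_one)
    then show ?thesis
      by (meson continuous_at_imp_continuous_on differentiable_imp_continuous_within)
  qed
  \<comment> \<open>Radius \<open>\<epsilon>\<close> keeps the parameter in \<open>S\<close>, where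
    \<open>F 0\<close> recovers the abscissa; radius \<open>\<epsilon>2\<close> keeps the height
    within \<open>\<delta>\<close> of \<open>h c\<close>.\<close>
  obtain \<eta> where \<eta>: "\<eta> > 0"
      "\<And>q. q \<in> path_image \<gamma> \<Longrightarrow> fst q < c + \<eta> \<Longrightarrow> q \<in> \<gamma> ` ball t0 (min \<epsilon> \<epsilon>2)"
  proof (rule points_near_leftmost[OF per simple cont left(1), of t0 "min \<epsilon> \<epsilon>2"])
    show "\<gamma> t = \<gamma> t0" if "fst (\<gamma> t) = c" for t using left(2)[OF that] t0 by simp
  qed (use \<epsilon> \<epsilon>2 in auto)
  show ?thesis
  proof (rule that[OF \<delta>(1) _ \<eta>(1) F0c F1 dF'])
    show "F 2 (h c) / 2 > 0" using F2_pos by simp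
    show "F 2 (h c) / 2 \<le> F 2 y" if "\<bar>y - h c\<bar> < \<delta>" for y
    proof -
      have "\<bar>F 2 y - F 2 (h c)\<bar> < \<bar>F 2 (h c)\<bar> / 2" using \<delta>2(2)[of y] that \<delta> by auto
      then show ?thesis using F2_pos by linarith
    qed
    show "\<bar>F (2 * k) y\<bar> \<le> \<bar>F (2 * k) (h c)\<bar> + 1" if "\<bar>y - h c\<bar> < \<delta>" for y
      using \<delta>3(2)[of y] that \<delta> by auto
    show "\<bar>snd q - h c\<bar> < \<delta> \<and> F 0 (snd q) = fst q" if "q \<in> \<Gamma>" "fst q < c + \<eta>" for q
    proof -
      have "q \<in> \<gamma> ` ball t0 (min \<epsilon> \<epsilon>2)" using \<eta>(2) img that by simp
      then obtain t where t: "dist t0 t < min \<epsilon> \<epsilon>2" "q = \<gamma> t" by (auto simp del: min_less_iff_conj)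
      then have "t \<in> S" by (simp add: S_def)
      then show ?thesis using \<epsilon>2(2)[of t] t FY by (simp add: XY0 dist_commute)
    qed
  qed
qed

section \<open>Minimum of the interpolating polynomial\<close>

text \<open>Makes the derivative of order \<open>n\<close> of the interpolation error equal to
  \<open>F n\<close>.\<close>

lemma higher_pderiv_eq_0:
  fixes p :: "'a::{comm_semiring_1,semiring_no_zero_divisors,semiring_char_0} poly"
  shows "degree p < n \<Longrightarrow> (pderiv ^^ n) p = 0"
proof (induction n arbitrary: p)
  case (Suc n)
  show ?case
  proof (cases "degree p = 0")
    case True
    then have "pderiv p = 0" by (simp add: pderiv_eq_0_iff)
    moreover have "(pderiv ^^ i) (0 :: 'a poly) = 0" for i by (induction i) auto
    ultimately show ?thesis by (simp add: funpow_swap1)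
  next
    case False
    then show ?thesis using Suc.IH[of "pderiv p"] Suc.prems by (simp add: funpow_swap1 degree_pderiv)
  qed
qed simp

context
  fixes F :: "nat \<Rightarrow> real \<Rightarrow> real" and y0 c \<delta> m :: real and n :: nat
  assumes n: "n \<ge> 2" and m: "m > 0" and F0: "F 0 y0 = c" and F1: "F 1 y0 = 0"
    and dF: "\<And>i y. i < n \<Longrightarrow> \<bar>y - y0\<bar> < \<delta> \<Longrightarrow> (F i has_real_derivative F (Suc i) y) (at y)"
    and F2: "\<And>y. \<bar>y - y0\<bar> < \<delta> \<Longrightarrow> m \<le> F 2 y"
begin

text \<open>Second order Taylor expansion at \<open>y0\<close>, where the linear term vanishes. It
  turns an abscissa gap into a height gap of square root size.\<close>

lemma quadratic_growth:
  assumes "\<bar>y - y0\<bar> < \<delta>"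
  shows "c + m / 2 * (y - y0)\<^sup>2 \<le> F 0 y"
proof (cases "y = y0")
  case False
  have "\<forall>i t. i < 2 \<and> min y y0 \<le> t \<and> t \<le> max y y0 \<longrightarrow> (F i has_real_derivative F (Suc i) t) (at t)"
    using n assms by (auto intro!: dF)
  with False obtain t where t: "if y < y0 then y < t \<and> t < y0 else y0 < t \<and> t < y"
    "F 0 y = (\<Sum>m<2. F m y0 / fact m * (y - y0) ^ m) + F 2 t / fact 2 * (y - y0)\<^sup>2"
    using Taylor[of 2 F "F 0" "min y y0" "max y y0" y0 y]
    by (auto simp del: One_nat_def)
  have "m \<le> F 2 t" using t(1) assms by (intro F2) (auto split: if_splits)
  then have "m / 2 * (y - y0)\<^sup>2 \<le> F 2 t / 2 * (y - y0)\<^sup>2"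
    by (intro mult_right_mono) auto
  then show ?thesis using t(2) F0 F1 by (simp add: lessThan_nat_numeral numeral_2_eq_2)
qed (use F0 in auto)

text \<open>Mean value theorem for \<open>F 1\<close>, starting from its zero
  \<open>y0\<close>.\<close>

lemma derivative_growth:
  assumes "\<bar>y - y0\<bar> < \<delta>"
  shows "y0 < y \<Longrightarrow> m * (y - y0) \<le> F 1 y" "y < y0 \<Longrightarrow> F 1 y \<le> - m * (y0 - y)"
proof -
  have d1: "(F 1 has_real_derivative F 2 t) (at t)" if "\<bar>t - y0\<bar> < \<delta>" for t
    using dF[of 1 t] n that by (simp add: numeral_2_eq_2)
  show "m * (y - y0) \<le> F 1 y" if less: "y0 < y"
  proof -
    obtain z where z: "y0 < z" "z < y" "F 1 y - F 1 y0 = (y - y0) * F 2 z"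
      using MVT2[OF less, where f = "F 1" and f' = "F 2"] d1 assms by auto
    have "(y - y0) * m \<le> (y - y0) * F 2 z"
      using z assms less by (intro mult_left_mono F2) auto
    then show ?thesis using z(3) F1 by (simp add: mult.commute)
  qed
  show "F 1 y \<le> - m * (y0 - y)" if less: "y < y0"
  proof -
    obtain z where z: "y < z" "z < y0" "F 1 y0 - F 1 y = (y0 - y) * F 2 z"
      using MVT2[OF less, where f = "F 1" and f' = "F 2"] d1 assms by auto
    have "(y0 - y) * m \<le> (y0 - y) * F 2 z"
      using z assms less by (intro mult_left_mono F2) auto
    then show ?thesis using z(3) F1 by (simp add: mult.commute)
  qed
qed

text \<open>Between two points of equal level \<open>F 1\<close> has a zero, and by
  \<open>derivative_growth\<close> its only zero is \<open>y0\<close>.\<close>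

lemma level_points_separated:
  assumes "u < v" "\<bar>u - y0\<bar> < \<delta>" "\<bar>v - y0\<bar> < \<delta>" "F 0 u = F 0 v"
  shows "u < y0" "y0 < v"
proof -
  have "\<exists>z>u. z < v \<and> F 0 v - F 0 u = (v - u) * F 1 z"
    using assms n dF[of 0] by (intro MVT2) auto
  then obtain z where z: "u < z" "z < v" "F 1 z = 0" using assms by auto
  have "z = y0"
    using derivative_growth[of z] z assms m
    by (cases z y0 rule: linorder_cases) (auto simp: mult_le_0_iff)
  then show "u < y0" "y0 < v" using z by auto
qed

text \<open>Since \<open>y0\<close> is interior to the search interval, it competes for the minimum
  of \<open>p\<close>, and a minimum point on either side can be moved towards \<open>y0\<close>
  without leaving the interval.\<close>

lemma interpolant_minimum:
  assumes r: "0 \<le> r" "r < \<delta>" and M: "\<And>y. \<bar>y - y0\<bar> < \<delta> \<Longrightarrow> \<bar>F n y\<bar> \<le> M"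
    and p: "degree p < n"
    and Z: "finite Z" "card Z = n" "Z \<subseteq> {y0 - r..y0 + r}" "\<And>z. z \<in> Z \<Longrightarrow> poly p z = F 0 z"
    and uv: "y0 - r \<le> u" "u < y0" "y0 < v" "v \<le> y0 + r"
    and y: "is_arg_min (poly p) (\<lambda>y. y \<in> {u..v}) y"
  shows "\<bar>c - poly p y\<bar> \<le> M * (2 * r) ^ n" "\<bar>y0 - y\<bar> \<le> M * (2 * r) ^ (n - 1) / m"
proof -
  define G where "G i t = F i t - poly ((pderiv ^^ i) p) t" for i t
  let ?I = "{y0 - r..y0 + r}"
  have I: "\<bar>t - y0\<bar> < \<delta>" if "t \<in> ?I" for t using that r by auto
  have dG: "(G i has_real_derivative G (Suc i) t) (at t)" if "i < n" "t \<in> ?I" for i t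
    unfolding G_def using dF[OF that(1) I[OF that(2)]] by (auto intro!: DERIV_diff poly_DERIV)
  have Gn: "\<bar>G n t\<bar> \<le> M" if "t \<in> ?I" for t
    using M[OF I[OF that]] higher_pderiv_eq_0[OF p] by (simp add: G_def)
  have G0: "G 0 z = 0" if "z \<in> Z" for z using Z(4)[OF that] by (simp add: G_def)
  have E0: "\<bar>G 0 t\<bar> \<le> M * (2 * r) ^ n" if "t \<in> ?I" for t
    using zeros_bound[of Z n "y0 - r" "y0 + r" G M t] Z dG Gn G0 that by simp
  obtain Z' where Z': "finite Z'" "card Z' = card Z - 1" "Z' \<subseteq> ?I" "\<forall>z\<in>Z'. G 1 z = 0"
    using Rolle_card[of Z "y0 - r" "y0 + r" "G 0" "G 1"] Z dG[of 0] n G0 by auto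
  \<comment> \<open>The \<open>n - 1\<close> zeros of \<open>G 1\<close> from Rolle allow the same
    bound for the shifted sequence, at the cost of one power of the width.\<close>
  have E1: "\<bar>G 1 t\<bar> \<le> M * (2 * r) ^ (n - 1)" if "t \<in> ?I" for t
    using zeros_bound[of Z' "n - 1" "y0 - r" "y0 + r" "\<lambda>i. G (Suc i)" M t] Z Z' dG Gn that n by simp
  have yuv: "u \<le> y" "y \<le> v" and min: "\<And>t. u \<le> t \<Longrightarrow> t \<le> v \<Longrightarrow> poly p y \<le> poly p t"
    using y by (auto simp: is_arg_min_linorder)
  have yI: "y \<in> ?I" and y0I: "y0 \<in> ?I" using yuv uv by auto
  \<comment> \<open>This bounds \<open>poly p y\<close> from below up to the error at
    \<open>y\<close>; comparison with \<open>poly p y0\<close> bounds it from above up to the error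
    at \<open>y0\<close>.\<close>
  have "c \<le> F 0 y"
    using quadratic_growth[OF I[OF yI]] m zero_le_power2[of "y - y0"]
    by (smt (verit) half_gt_zero mult_nonneg_nonneg)
  then show "\<bar>c - poly p y\<bar> \<le> M * (2 * r) ^ n"
    using E0[OF yI] E0[OF y0I] min[of y0] uv F0 by (simp add: G_def)
  have dp: "(poly p has_real_derivative poly (pderiv p) y) (at y)" by (rule poly_DERIV)
  have "m * \<bar>y0 - y\<bar> \<le> M * (2 * r) ^ (n - 1)"
  proof (cases y y0 rule: linorder_cases)
    case less
    have "0 \<le> poly (pderiv p) y"
    proof (rule ccontr)
      assume "\<not> ?thesis"
      then obtain e where e: "e > 0" "\<And>s. 0 < s \<Longrightarrow> s < e \<Longrightarrow> poly p (y + s) < poly p y"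
        using DERIV_neg_dec_right[OF dp] by auto
      \<comment> \<open>A move to the right that is short enough for the descent and stays within
        the interval, even when \<open>y = u\<close>.\<close>
      define s where "s = min (e / 2) (v - y)"
      have "s > 0" "s < e" "y + s \<le> v" using e less uv by (auto simp: s_def)
      then show False using e(2)[of s] min[of "y + s"] yuv by auto
    qed
    then show ?thesis
      using derivative_growth(2)[OF I[OF yI] less] E1[OF yI] less by (simp add: G_def)
  next
    case equal
    then show ?thesis using E1[OF y0I] by simp
  next
    case greater
    have "poly (pderiv p) y \<le> 0"
    proof (rule ccontr)
      assume "\<not> ?thesis"
      then obtain e where e: "e > 0" "\<And>s. 0 < s \<Longrightarrow> s < e \<Longrightarrow> poly p (y - s) < poly p y"
        using DERIV_pos_inc_left[OF dp] by auto
      define s where "s = min (e / 2) (y - u)"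
      have "s > 0" "s < e" "u \<le> y - s" using e greater uv by (auto simp: s_def)
      then show False using e(2)[of s] min[of "y - s"] yuv by auto
    qed
    then show ?thesis
      using derivative_growth(1)[OF I[OF yI] greater] E1[OF yI] greater by (simp add: G_def)
  qed
  then show "\<bar>y0 - y\<bar> \<le> M * (2 * r) ^ (n - 1) / m"
    using m by (simp add: field_simps)
qed

end

section \<open>Sample points and nodes near the left end\<close>

text \<open>The first grid point beyond \<open>c\<close> is at most one step away from it, and the
  fineness condition leaves room for \<open>2 * k + 2\<close> grid points before
  \<open>d\<close>.\<close>

lemma samples_right_of_left_end:
  assumes "a < c" "c < d" "d < b" "N > 0" and fine: "(2 * real k + 2) * mesh a b N < d - c"
  shows "enough_samples k a b c d N"
    and "\<And>i. i \<in> {first_index a b c d N..<first_index a b c d N + k} \<Longrightarrow>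
      c < sample_pt a b N i \<and> sample_pt a b N i \<le> c + real k * mesh a b N"
proof -
  let ?x = "sample_pt a b N"
  have mesh: "mesh a b N > 0" using assms by (simp add: mesh_def)
  have xN: "?x N = b" using assms(4) by (simp add: sample_pt_def mesh_def)
  have mono: "?x i < ?x j \<longleftrightarrow> i < j" for i j using mesh by (simp add: sample_pt_def)
  define j where "j = (LEAST j. c < ?x j)"
  have xj: "c < ?x j" unfolding j_def by (rule LeastI[of _ N]) (use xN assms in simp)
  have least: "j \<le> i" if "c < ?x i" for i unfolding j_def using that by (rule Least_le)
  \<comment> \<open>Index 0 belongs to \<open>a < c\<close>, so \<open>j\<close> has a predecessor,
    whose sample point is at most \<open>c\<close>.\<close>
  have "j \<noteq> 0" using xj assms(1) by (auto simp: sample_pt_def intro: ccontr)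
  then have "?x (j - 1) \<le> c" using least[of "j - 1"] by fastforce
  then have up: "?x (j + i) \<le> c + (real i + 1) * mesh a b N" for i
    using \<open>j \<noteq> 0\<close> by (simp add: sample_pt_def of_nat_diff algebra_simps)
  have lo: "c < ?x (j + i)" for i using xj mono[of j "j + i"] by (cases i) auto
  have mem: "j + i \<in> hole_indices a b c d N" if "i \<le> 2 * k + 1" for i
  proof -
    have "(real i + 1) * mesh a b N \<le> (2 * real k + 2) * mesh a b N"
      using that mesh by (intro mult_right_mono) auto
    then have "?x (j + i) < d" using up[of i] fine by linarith
    moreover then have "j + i \<le> N" using mono[of "j + i" N] xN assms(3) by linarith
    ultimately show ?thesis using lo by (simp add: hole_indices_def)
  qed
  have fin: "finite (hole_indices a b c d N)"
    by (rule finite_subset[of _ "{..N}"]) (auto simp: hole_indices_def)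
  have first: "first_index a b c d N = j"
    unfolding first_index_def using fin mem[of 0] least
    by (intro Min_eqI) (auto simp: hole_indices_def)
  have "j + (2 * k + 1) \<le> last_index a b c d N"
    unfolding last_index_def using fin mem[of "2 * k + 1"] by (intro Max_ge) auto
  then show "enough_samples k a b c d N"
    using mem[of 0] first assms(4) by (auto simp: enough_samples_def)
  fix i assume "i \<in> {first_index a b c d N..<first_index a b c d N + k}"
  then obtain l where l: "i = j + l" "l < k" using first by (auto simp: le_iff_add)
  have "(real l + 1) * mesh a b N \<le> real k * mesh a b N"
    using l mesh by (intro mult_right_mono) auto
  then show "c < ?x i \<and> ?x i \<le> c + real k * mesh a b N"
    using lo[of l] up[of l] l by auto
qed

text \<open>A common left inverse \<open>f\<close> makes \<open>g\<close> and \<open>h\<close>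
  injective on the samples; a shared value would come from one sample \<open>x\<close>, against
  \<open>g x < h x\<close>. So the \<open>2 * k\<close> nodes are distinct and the definite
  description is meaningful.\<close>

lemma reflected_poly_interpolates:
  fixes k :: nat and a b c d :: real and g h f :: "real \<Rightarrow> real" and N :: nat
  defines "A \<equiv> sample_pt a b N ` {first_index a b c d N..<first_index a b c d N + k}"
  assumes mesh: "mesh a b N > 0" and k: "k \<ge> 1"
    and gh: "\<And>x. x \<in> A \<Longrightarrow> f (g x) = x \<and> f (h x) = x \<and> g x < h x"
  shows "card (g ` A \<union> h ` A) = 2 * k"
    and "degree (reflected_poly k g h a b c d N) < 2 * k"
    and "\<And>z. z \<in> g ` A \<union> h ` A \<Longrightarrow> poly (reflected_poly k g h a b c d N) z = f z"
proof -
  have finA: "finite A" by (simp add: A_def)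
  have "inj_on (sample_pt a b N) S" for S
    using mesh by (auto simp: inj_on_def sample_pt_def)
  then have "card A = k" by (simp add: A_def card_image)
  moreover have "inj_on g A" "inj_on h A" using gh by (metis inj_onI)+
  moreover have "g ` A \<inter> h ` A = {}" using gh by (auto, metis less_irrefl)
  ultimately show card: "card (g ` A \<union> h ` A) = 2 * k"
    using finA by (simp add: card_Un_disjoint card_image)
  let ?P = "\<lambda>p. degree p \<le> 2 * k - 1 \<and>
        (\<forall>i \<in> {first_index a b c d N ..< first_index a b c d N + k}.
           poly p (g (sample_pt a b N i)) = sample_pt a b N i \<and>
           poly p (h (sample_pt a b N i)) = sample_pt a b N i)"
  have P: "?P p \<longleftrightarrow> degree p \<le> 2 * k - 1 \<and> (\<forall>z\<in>g ` A \<union> h ` A. poly p z = f z)" for p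
    using gh by (auto simp: A_def)
  obtain p where p: "?P p"
    using interpolation_exists[of "g ` A \<union> h ` A" f] finA card unfolding P by auto
  have "?P (reflected_poly k g h a b c d N)"
    unfolding reflected_poly_def
  proof (rule theI)
    show "?P p" by (rule p)
    show "q = p" if "?P q" for q
      using that p k finA card unfolding P
      by (intro interpolation_unique[of "g ` A \<union> h ` A"]) auto
  qed
  then show "degree (reflected_poly k g h a b c d N) < 2 * k"
    and "\<And>z. z \<in> g ` A \<union> h ` A \<Longrightarrow> poly (reflected_poly k g h a b c d N) z = f z"
    using k unfolding P by auto
qed

section \<open>Asymptotics as the mesh tends to zero\<close>

lemma mesh_tendsto_0: "mesh a b \<longlonglongrightarrow> 0"
  unfolding mesh_def[abs_def] by (intro tendsto_divide_0[OF tendsto_const] filterlim_real_at_infinity_sequentially)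

theorem proposition5p1:
  fixes k :: nat and a b c d :: real and g h :: "real \<Rightarrow> real"
    and \<Gamma> :: "(real \<times> real) set" and \<gamma> :: "real \<Rightarrow> real \<times> real"
    and ytilde px py :: "nat \<Rightarrow> real"
  assumes k_pos: "k \<ge> 1"
    and interval: "a < c" "c < d" "d < b"
    and bounds: "\<And>x. c < x \<Longrightarrow> x < d \<Longrightarrow> g x < h x" "g c = h c" "g d = h d"
    and boundary: "\<Gamma> = hole_boundary g h c d"
    and interior: "hole_region g h c d = inside \<Gamma>"
    and smooth: "closed_curve_param (2 * k) \<gamma> \<Gamma>"
    and vertical: "\<And>x. c < x \<Longrightarrow> x < d \<Longrightarrow> card (\<Gamma> \<inter> {x} \<times> UNIV) = 2"
    and curv_c: "\<And>t. \<gamma> t = (c, h c) \<Longrightarrow> curvature \<gamma> t \<noteq> 0"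
    and curv_d: "\<And>t. \<gamma> t = (d, h d) \<Longrightarrow> curvature \<gamma> t \<noteq> 0"
    and min_point: "\<And>N. enough_samples k a b c d N \<Longrightarrow>
      is_arg_min (poly (reflected_poly k g h a b c d N))
        (\<lambda>y. y \<in> search_interval k g h a b c d N) (ytilde N)"
    and px: "\<And>N. enough_samples k a b c d N \<Longrightarrow>
      px N = poly (reflected_poly k g h a b c d N) (ytilde N)"
    and py: "\<And>N. enough_samples k a b c d N \<Longrightarrow> py N = ytilde N"
  shows "(\<lambda>N. dist (c, h c) (px N, py N)) \<in> O[sequentially](\<lambda>N. mesh a b N powr (real k - 1 / 2))
    \<and> (\<lambda>N. \<bar>c - px N\<bar>) \<in> O[sequentially](\<lambda>N. mesh a b N ^ k)
    \<and> (\<lambda>N. \<bar>h c - py N\<bar>) \<in> O[sequentially](\<lambda>N. mesh a b N powr (real k - 1 / 2))"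
proof -
  obtain F :: "nat \<Rightarrow> real \<Rightarrow> real" and \<delta> m M \<eta> where
    pos: "\<delta> > 0" "m > 0" "\<eta> > 0" and F01: "F 0 (h c) = c" "F 1 (h c) = 0" and
    dF: "\<And>i y. i < 2 * k \<Longrightarrow> \<bar>y - h c\<bar> < \<delta> \<Longrightarrow> (F i has_real_derivative F (Suc i) y) (at y)" and
    F2: "\<And>y. \<bar>y - h c\<bar> < \<delta> \<Longrightarrow> m \<le> F 2 y" and
    M: "\<And>y. \<bar>y - h c\<bar> < \<delta> \<Longrightarrow> \<bar>F (2 * k) y\<bar> \<le> M" and
    near: "\<And>q. q \<in> \<Gamma> \<Longrightarrow> fst q < c + \<eta> \<Longrightarrow> \<bar>snd q - h c\<bar> < \<delta> \<and> F 0 (snd q) = fst q"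
  proof (rule local_graph[OF k_pos interval(2) bounds(2) boundary smooth curv_c], goal_cases)
    case (2 F \<delta> m M \<eta>)
    show ?case by (rule 2(1)[OF 2(2-)])
  qed
  have k2: "2 \<le> 2 * k" using k_pos by simp
  note quad = quadratic_growth[where \<delta> = \<delta>, OF k2 pos(2) F01 dF F2]
    and sep = level_points_separated[where \<delta> = \<delta>, OF k2 pos(2) F01 dF F2]
  \<comment> \<open>Quadratic growth bounds the squared distance of a node from \<open>h c\<close>
    by \<open>2 * k / m\<close> times the mesh. This is \<open>K / 4\<close> times the mesh, so
    \<open>2 * r\<close> below is the root of \<open>K * D\<close>.\<close>
  define K where "K = 8 * real k / m"
  have K: "K > 0" using k_pos pos by (simp add: K_def)
  have "M \<ge> 0" using M[of "h c"] pos by auto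
  \<comment> \<open>The three smallness conditions give, in turn, enough samples, \<open>k\<close>
    sample points within \<open>\<eta>\<close> of \<open>c\<close>, and
    \<open>r < \<delta>\<close>.\<close>
  have key: "\<bar>c - px N\<bar> \<le> M * K ^ k * mesh a b N ^ k \<and>
      \<bar>h c - py N\<bar> \<le> M * K powr (real k - 1/2) / m * mesh a b N powr (real k - 1/2)"
    if N: "N > 0" and D1: "(2 * real k + 2) * mesh a b N < d - c" and
      D2: "real k * mesh a b N < \<eta>" and D3: "K * mesh a b N < (2 * \<delta>)\<^sup>2" for N
  proof -
    define D where "D = mesh a b N"
    have D: "D > 0" using interval N by (simp add: D_def mesh_def)
    define r where "r = sqrt (K * D) / 2"
    have "sqrt (K * D) < 2 * \<delta>"
      using D3 pos by (intro real_less_lsqrt) (auto simp: D_def)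
    then have r: "r \<ge> 0" "r < \<delta>" using K D by (auto simp: r_def)
    define I where "I = {first_index a b c d N..<first_index a b c d N + k}"
    define A where "A = sample_pt a b N ` I"
    have enough: "enough_samples k a b c d N"
      by (rule samples_right_of_left_end[OF interval N D1])
    have A: "c < x" "x \<le> c + real k * D" if "x \<in> A" for x
      using samples_right_of_left_end(2)[OF interval N D1] that by (auto simp: A_def I_def D_def)
    have "real k * D \<le> (2 * real k + 2) * D" using D by (intro mult_right_mono) auto
    then have A_d: "x < d" if "x \<in> A" for x using A[OF that] D1 by (simp add: D_def)
    have on_graph: "\<bar>g x - h c\<bar> < \<delta> \<and> F 0 (g x) = x" "\<bar>h x - h c\<bar> < \<delta> \<and> F 0 (h x) = x"
      if "x \<in> A" for x
      using near[of "(x, g x)"] near[of "(x, h x)"] A[OF that] A_d[OF that] D2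
      by (auto simp: boundary hole_boundary_def D_def)
    have lt: "g x < h x" if "x \<in> A" for x using bounds(1) A[OF that] A_d[OF that] by auto
    \<comment> \<open>Both heights have the same level \<open>x\<close> under
      \<open>F 0\<close>.\<close>
    have sides: "g x < h c" "h c < h x" if "x \<in> A" for x
      using sep[of "g x" "h x"] lt[OF that] on_graph[OF that] by metis+
    have in_r: "y \<in> {h c - r..h c + r}" if "\<bar>y - h c\<bar> < \<delta>" "F 0 y = x" "x \<in> A" for x y
    proof -
      have "m / 2 * (y - h c)\<^sup>2 \<le> real k * D"
        using quad[of y] that A(2)[of x] by auto
      then have "(y - h c)\<^sup>2 \<le> K * D / 4" using pos by (simp add: K_def field_simps)
      then have "\<bar>y - h c\<bar> \<le> sqrt (K * D / 4)"
        by (metis real_sqrt_abs real_sqrt_le_iff)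
      then have "\<bar>y - h c\<bar> \<le> r" by (simp add: r_def real_sqrt_divide)
      then show ?thesis by auto
    qed
    define Z where "Z = g ` A \<union> h ` A"
    have rp: "card Z = 2 * k" "degree (reflected_poly k g h a b c d N) < 2 * k"
      "\<And>z. z \<in> Z \<Longrightarrow> poly (reflected_poly k g h a b c d N) z = F 0 z"
      using reflected_poly_interpolates[of a b N k c d "F 0" g h] D k_pos on_graph lt
      unfolding D_def Z_def A_def I_def by blast+
    have Zr: "finite Z" "Z \<subseteq> {h c - r..h c + r}"
      using on_graph in_r by (auto simp: Z_def A_def I_def)
    \<comment> \<open>The outermost of the \<open>k\<close> samples; the ends of the search interval
      are themselves nodes, hence within \<open>r\<close> of \<open>h c\<close>.\<close>
    define xl where "xl = sample_pt a b N (first_index a b c d N + k - 1)"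
    have xl: "xl \<in> A" using k_pos by (auto simp: xl_def A_def I_def)
    have min: "is_arg_min (poly (reflected_poly k g h a b c d N)) (\<lambda>y. y \<in> {g xl..h xl}) (ytilde N)"
      using min_point[OF enough] by (simp add: search_interval_def xl_def)
    have ends: "h c - r \<le> g xl" "h xl \<le> h c + r"
      using on_graph[OF xl] in_r[OF _ _ xl] by auto
    note min_est = interpolant_minimum[where F = F and \<delta> = \<delta> and M = M, OF k2 pos(2) F01 _ _ r _
        rp(2) Zr(1) rp(1) Zr(2) _ ends(1) sides[OF xl] ends(2) min]
    have est: "\<bar>c - px N\<bar> \<le> M * (2 * r) ^ (2 * k)" "\<bar>h c - py N\<bar> \<le> M * (2 * r) ^ (2 * k - 1) / m"
      unfolding px[OF enough] py[OF enough] by - (rule min_est; rule dF F2 M rp(3); assumption)+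
    \<comment> \<open>The even power of the root is an integer power of the mesh; the odd one below
      leaves a half-integer exponent, the source of the lost half order.\<close>
    have "(2 * r) ^ (2 * k) = K ^ k * D ^ k"
      using K D by (simp add: r_def power_mult power_mult_distrib)
    moreover have "(2 * r) ^ (2 * k - 1) = K powr (real k - 1/2) * D powr (real k - 1/2)"
    proof -
      have "(2 * r) ^ (2 * k - 1) = ((K * D) powr (1/2)) powr real (2 * k - 1)"
        using K D by (simp add: r_def powr_half_sqrt powr_realpow)
      also have "\<dots> = (K * D) powr (real k - 1/2)"
        using k_pos by (simp add: powr_powr of_nat_diff field_simps)
      finally show ?thesis using K D by (simp add: powr_mult)
    qed
    ultimately show ?thesis using est by (simp add: D_def mult.assoc)
  qed
  have small: "eventually (\<lambda>N. C * mesh a b N < e) sequentially" if "e > 0" for C e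
    using tendsto_mult_right_zero[OF mesh_tendsto_0[of a b], of C] that by (rule order_tendstoD(2))
  have ev: "eventually (\<lambda>N. 0 < mesh a b N \<and> mesh a b N < 1 \<and>
      \<bar>c - px N\<bar> \<le> M * K ^ k * mesh a b N ^ k \<and>
      \<bar>h c - py N\<bar> \<le> M * K powr (real k - 1/2) / m * mesh a b N powr (real k - 1/2)) sequentially"
  proof -
    have "eventually (\<lambda>N. N > 0) sequentially" by (rule eventually_gt_at_top)
    moreover have "eventually (\<lambda>N. mesh a b N < 1) sequentially" using small[of 1 1] by simp
    moreover have "eventually (\<lambda>N. (2 * real k + 2) * mesh a b N < d - c) sequentially"
      using interval by (intro small) simp
    moreover have "eventually (\<lambda>N. real k * mesh a b N < \<eta>) sequentially"
      by (rule small[OF pos(3)])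
    moreover have "eventually (\<lambda>N. K * mesh a b N < (2 * \<delta>)\<^sup>2) sequentially"
      using pos by (intro small) simp
    ultimately show ?thesis
    proof eventually_elim
      case (elim N)
      then show ?case using key[of N] interval by (simp add: mesh_def)
    qed
  qed
  have px_O: "(\<lambda>N. \<bar>c - px N\<bar>) \<in> O(\<lambda>N. mesh a b N ^ k)"
    by (rule bigoI[of _ "M * K ^ k"], rule eventually_mono[OF ev]) simp
  have py_O: "(\<lambda>N. \<bar>h c - py N\<bar>) \<in> O(\<lambda>N. mesh a b N powr (real k - 1/2))"
    by (rule bigoI[of _ "M * K powr (real k - 1/2) / m"], rule eventually_mono[OF ev]) simp
  \<comment> \<open>For a mesh below 1 the larger exponent gives the smaller power, so the first
    coordinate's error is absorbed by the second's bound.\<close>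
  have pow_O: "(\<lambda>N. mesh a b N ^ k) \<in> O(\<lambda>N. mesh a b N powr (real k - 1/2))"
  proof (rule bigoI[of _ 1], rule eventually_mono[OF ev], elim conjE)
    fix N assume N: "0 < mesh a b N" "mesh a b N < 1"
    then have "mesh a b N powr real k \<le> mesh a b N powr (real k - 1/2)"
      by (intro powr_mono') auto
    then show "norm (mesh a b N ^ k) \<le> 1 * norm (mesh a b N powr (real k - 1/2))"
      using N by (simp add: powr_realpow)
  qed
  have "(\<lambda>N. dist (c, h c) (px N, py N)) \<in> O(\<lambda>N. \<bar>c - px N\<bar> + \<bar>h c - py N\<bar>)"
    by (rule bigoI[of _ 1]) (simp add: dist_Pair_Pair dist_real_def sqrt_sum_squares_le_sum_abs)
  also have "(\<lambda>N. \<bar>c - px N\<bar> + \<bar>h c - py N\<bar>) \<in> O(\<lambda>N. mesh a b N powr (real k - 1/2))"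
    using landau_o.big_trans[OF px_O pow_O] py_O by (rule sum_in_bigo)
  finally show ?thesis using px_O py_O by blast
qed

end
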